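(* Let $N \ge 2$ be an integer and, for $2 \le n \le N$, let $a_n$ be non-negative integers with at least one of them positive. Let $\mathcal{Q}(t) = t - \sum_{n=2}^N a_n t^n$, and let $t_{\mathcal{Q}}$ be the unique zero of the derivative $\mathcal{Q}'$ in $(0,\infty)$. Let $G$ be a second countable, locally compact, Hausdorff topological group. Consider any non-negative $\psi \in L^1(G)$ with $$\|\psi\|_{L^1(G)} \le \mathcal{Q}(t_{\mathcal{Q}}).$$ Define $\Psi_j$, $j \in \mathbb{N}\cup\{0\}$, inductively by $$\Psi_0 := \psi, \qquad \Psi_{j+1} := \psi + \sum_{n=2}^N a_n \left( *^n \Psi_j\right), \quad j \in \mathbb{N}\cup\{0\}.$$ Then $\{\Psi_j\}_{j=0}^\infty$ converges in the topology of $L^1(G)$ to an element $\Psi \in L^1(G)$ which satisfies $$\Psi \ge 0, \qquad \|\Psi\|_{L^1(G)} \le t_{\mathcal{Q}}, \qquad \psi = \Psi - \sum_{n=2}^N a_n \left( *^n \Psi\right).$$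
   Context: $L^1(G)$ is taken with respect to a fixed left Haar measure $dy$ on $G$, and convolution is $(f*g)(x) = \int_G f(y)\, g(y^{-1}x)\, dy$. For $n \ge 1$, $*^n f = f * \cdots * f$ denotes the $n$-fold convolution of $f$ with itself ($n$ factors). Equalities and inequalities between elements of $L^1(G)$ are understood almost everywhere. $\mathbb{N}$ is the set of positive integers. Since the $a_n$ are non-negative with at least one positive, $\mathcal{Q}'$ has exactly one zero in $(0,\infty)$, so $t_{\mathcal{Q}}$ is well defined. *)

theory Defs
  imports "HOL-Analysis.Analysis"
begin

text \<open>
  The group is a type of class \<^class>\<open>topological_group_add\<close>.  This class does not assume
  commutativity; additive notation is only the library's notation for topological groups, so
  \<open>x + y\<close>, \<open>- x\<close>, \<open>0\<close> stand for \<open>x y\<close>, the inverse of \<open>x\<close>, and the identity.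
  An element of \<open>L\<^sup>1(G)\<close> is represented by an integrable function, equality being equality
  almost everywhere; since only non-negative functions occur, scalars are real.
\<close>

text \<open>A left Haar measure is a nonzero left-invariant Radon measure on the Borel sets.\<close>

definition left_haar_measure :: "'a::topological_group_add measure \<Rightarrow> bool" where
  "left_haar_measure M \<longleftrightarrow>
     sets M = sets borel \<and>
     emeasure M UNIV \<noteq> 0 \<and>
     (\<forall>K. compact K \<longrightarrow> emeasure M K < \<infinity>) \<and>
     (\<forall>A\<in>sets borel. emeasure M A = (INF U\<in>{U. open U \<and> A \<subseteq> U}. emeasure M U)) \<and>
     (\<forall>U. open U \<longrightarrow> emeasure M U = (SUP K\<in>{K. compact K \<and> K \<subseteq> U}. emeasure M K)) \<and>
     (\<forall>x. \<forall>A\<in>sets borel. emeasure M ((\<lambda>y. x + y) ` A) = emeasure M A)"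

definition L1_norm :: "'a measure \<Rightarrow> ('a \<Rightarrow> real) \<Rightarrow> real" where
  "L1_norm M f = (\<integral>x. \<bar>f x\<bar> \<partial>M)"

definition convolution ::
  "'a::group_add measure \<Rightarrow> ('a \<Rightarrow> real) \<Rightarrow> ('a \<Rightarrow> real) \<Rightarrow> 'a \<Rightarrow> real" where
  "convolution M f g = (\<lambda>x. \<integral>y. f y * g (- y + x) \<partial>M)"

text \<open>The product has \<open>n\<close> factors for \<open>n \<ge> 1\<close>; the value at \<open>n = 0\<close> is irrelevant.\<close>

definition conv_power :: "'a::group_add measure \<Rightarrow> nat \<Rightarrow> ('a \<Rightarrow> real) \<Rightarrow> 'a \<Rightarrow> real" where
  "conv_power M n f = (convolution M f ^^ (n - 1)) f"

definition Q_poly :: "nat \<Rightarrow> (nat \<Rightarrow> nat) \<Rightarrow> real \<Rightarrow> real" where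
  "Q_poly N a t = t - (\<Sum>n=2..N. real (a n) * t ^ n)"

definition t_Q :: "nat \<Rightarrow> (nat \<Rightarrow> nat) \<Rightarrow> real" where
  "t_Q N a = (THE t. 0 < t \<and> deriv (Q_poly N a) t = 0)"

primrec Psi_seq ::
  "'a::group_add measure \<Rightarrow> nat \<Rightarrow> (nat \<Rightarrow> nat) \<Rightarrow> ('a \<Rightarrow> real) \<Rightarrow> nat \<Rightarrow> 'a \<Rightarrow> real" where
  "Psi_seq M N a \<psi> 0 = \<psi>"
| "Psi_seq M N a \<psi> (Suc j) =
     (\<lambda>x. \<psi> x + (\<Sum>n=2..N. real (a n) * conv_power M n (Psi_seq M N a \<psi> j) x))"

lemma deriv_Q_poly:
  "deriv (Q_poly N a) t = 1 - (\<Sum>n=2..N. real (a n) * (real n * t ^ (n - 1)))"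
  unfolding Q_poly_def
  by (rule DERIV_imp_deriv) (auto intro!: derivative_eq_intros sum.cong)

lemma ex1_t_Q:
  assumes "\<exists>n\<in>{2..N}. 0 < a n"
  shows "\<exists>!t. 0 < t \<and> deriv (Q_poly N a) t = 0"
proof -
  define g where "g t = (\<Sum>n=2..N. real (a n) * (real n * t ^ (n - 1)))" for t :: real
  obtain m where m: "m \<in> {2..N}" "0 < a m" using assms by blast
  have less: "g s < g t" if "0 \<le> s" "s < t" for s t
    unfolding g_def
  proof (rule sum_strict_mono_ex1)
    show "\<forall>n\<in>{2..N}. real (a n) * (real n * s ^ (n - 1)) \<le> real (a n) * (real n * t ^ (n - 1))"
      using that by (auto intro!: mult_left_mono power_mono)
    have "s ^ (m - 1) < t ^ (m - 1)"
      using that m by (intro power_strict_mono) auto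
    then show "\<exists>n\<in>{2..N}. real (a n) * (real n * s ^ (n - 1)) < real (a n) * (real n * t ^ (n - 1))"
      using m by (intro bexI[of _ m]) auto
  qed simp
  have g0: "g 0 = 0"
    unfolding g_def by (rule sum.neutral) (auto simp: power_0_left)
  have "1 * (1 * 1) \<le> real (a m) * (real m * 1 ^ (m - 1))"
    using m by (intro mult_mono) auto
  also have "\<dots> \<le> g 1"
    unfolding g_def by (rule member_le_sum[OF m(1)]) auto
  finally have g1: "1 \<le> g 1" by simp
  have "continuous_on {0..1} g"
    unfolding g_def by (intro continuous_intros)
  with g0 g1 obtain t where t: "0 \<le> t" "g t = 1"
    using IVT'[of g 0 1 1] by auto
  have pos: "0 < t" using t g0 by (cases "t = 0") auto
  have uniq: "s = t" if "0 < s" "g s = 1" for s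
    using less[of s t] less[of t s] that t by (cases s t rule: linorder_cases) auto
  have "deriv (Q_poly N a) s = 1 - g s" for s
    by (simp add: deriv_Q_poly g_def)
  then have eq: "(0 < s \<and> deriv (Q_poly N a) s = 0) = (0 < s \<and> g s = 1)" for s
    by auto
  show ?thesis
    unfolding eq
  proof (rule ex1I)
    show "0 < t \<and> g t = 1" using pos t by blast
    show "s = t" if "0 < s \<and> g s = 1" for s using uniq that by blast
  qed
qed

end

theory Submission
  imports Defs
begin

text \<open>
  Non-negativity turns the fixed-point problem into a monotone one.  Read in \<open>[0, \<infinity>]\<close>, the map
  \<open>F \<mapsto> \<psi> + \<Sum>\<^sub>n a\<^sub>n (*\<^sup>n F)\<close> is increasing, so the iterates increase from \<open>\<psi>\<close> and have a
  pointwise supremum \<open>L\<close>.  By monotone convergence the map commutes with suprema of increasing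
  sequences (\<open>nn_step_SUP\<close>), so \<open>L\<close> is a fixed point at every point of the group.

  Size is controlled by Tonelli's theorem and left invariance: the integral is multiplicative
  for convolutions of non-negative functions (\<open>nn_integral_nn_conv\<close>).  If \<open>I\<^sub>j\<close> is the integral
  of the \<open>j\<close>-th iterate, then \<open>I\<^sub>j\<^sub>+\<^sub>1 = \<parallel>\<psi>\<parallel> + \<Sum>\<^sub>n a\<^sub>n I\<^sub>j\<^sup>n\<close>, and the hypothesis
  \<open>\<parallel>\<psi>\<parallel> \<le> t - \<Sum>\<^sub>n a\<^sub>n t\<^sup>n\<close> makes the bound \<open>I\<^sub>j \<le> t\<close> pass from \<open>j\<close> to \<open>j + 1\<close>.
  Hence the integral of \<open>L\<close> is at most \<open>t\<close>, \<open>L\<close> is finite almost everywhere, and the real iterates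
  converge to it in \<open>L\<^sup>1\<close> by dominated convergence with \<open>L\<close> itself as majorant.

  The passage between real and extended functions is almost everywhere only, and is carried by
  \<open>nn_version_convolution\<close>.  The Fubini arguments need a \<open>\<sigma>\<close>-finite measure;
  \<open>sigma_finite_measure_locally_compact\<close> supplies this from second countability.
\<close>

section \<open>Convolution of non-negative functions for a left-invariant measure\<close>

definition nn_conv ::
  "'a::group_add measure \<Rightarrow> ('a \<Rightarrow> ennreal) \<Rightarrow> ('a \<Rightarrow> ennreal) \<Rightarrow> 'a \<Rightarrow> ennreal" where
  "nn_conv M F G = (\<lambda>x. \<integral>\<^sup>+y. F y * G (- y + x) \<partial>M)"

definition nn_conv_power ::
  "'a::group_add measure \<Rightarrow> nat \<Rightarrow> ('a \<Rightarrow> ennreal) \<Rightarrow> 'a \<Rightarrow> ennreal" where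
  "nn_conv_power M n F = (nn_conv M F ^^ (n - 1)) F"

definition nn_step ::
  "'a::group_add measure \<Rightarrow> nat \<Rightarrow> (nat \<Rightarrow> nat) \<Rightarrow> ('a \<Rightarrow> ennreal) \<Rightarrow> ('a \<Rightarrow> ennreal) \<Rightarrow> 'a \<Rightarrow> ennreal"
  where "nn_step M N a p F = (\<lambda>x. p x + (\<Sum>n=2..N. of_nat (a n) * nn_conv_power M n F x))"

lemma nn_conv_mono: "F \<le> F' \<Longrightarrow> G \<le> G' \<Longrightarrow> nn_conv M F G \<le> nn_conv M F' G'"
  unfolding nn_conv_def le_fun_def by (intro allI nn_integral_mono mult_mono) auto

lemma nn_conv_funpow_mono:
  "F \<le> F' \<Longrightarrow> (nn_conv M F ^^ k) F \<le> (nn_conv M F' ^^ k) F'"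
  by (induction k) (auto intro: nn_conv_mono)

lemma nn_step_mono: "F \<le> F' \<Longrightarrow> nn_step M N a p F \<le> nn_step M N a p F'"
  using nn_conv_funpow_mono[of F F' _ M]
  unfolding nn_step_def nn_conv_power_def le_fun_def
  by (intro allI add_mono sum_mono mult_left_mono order_refl) auto

lemma incseq_nn_step_iterates: "incseq (\<lambda>j. (nn_step M N a p ^^ j) p)"
proof (rule incseq_SucI)
  show "(nn_step M N a p ^^ j) p \<le> (nn_step M N a p ^^ Suc j) p" for j
  proof (induction j)
    case 0
    show ?case by (auto simp: nn_step_def le_fun_def)
  next
    case (Suc j)
    then show ?case using nn_step_mono by fastforce
  qed
qed

text \<open>
  Continuity of multiplication would not give this, because it fails in \<open>[0, \<infinity>]\<close> at
  \<open>0 \<cdot> \<infinity>\<close>; the double supremum of \<open>f i * g j\<close> is instead dominated by its diagonal.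
\<close>

lemma SUP_mult_incseq_ennreal:
  fixes f g :: "nat \<Rightarrow> ennreal"
  assumes "incseq f" "incseq g"
  shows "(SUP i. f i * g i) = (SUP i. f i) * (SUP i. g i)"
proof (rule antisym)
  show "(SUP i. f i * g i) \<le> (SUP i. f i) * (SUP i. g i)"
    by (intro SUP_least mult_mono SUP_upper) auto
  have "f i * g j \<le> (SUP i. f i * g i)" for i j
  proof -
    have "f i * g j \<le> f (max i j) * g (max i j)"
      using assms by (intro mult_mono) (auto simp: incseq_def)
    also have "\<dots> \<le> (SUP i. f i * g i)" by (rule SUP_upper) simp
    finally show ?thesis .
  qed
  then show "(SUP i. f i) * (SUP i. g i) \<le> (SUP i. f i * g i)"
    unfolding SUP_mult_left_ennreal SUP_mult_right_ennreal by (intro SUP_least)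
qed

locale left_invariant_sigma_finite = sigma_finite_measure M
  for M :: "'a::{topological_group_add, second_countable_topology} measure" +
  assumes sets_borel: "sets M = sets borel"
    and left_invariant: "A \<in> sets borel \<Longrightarrow> emeasure M ((\<lambda>y. x + y) ` A) = emeasure M A"
begin

sublocale pair: pair_sigma_finite M M ..

lemma space_UNIV [simp]: "space M = UNIV"
  using sets_eq_imp_space_eq[OF sets_borel] by simp

lemma left_quotient_measurable [measurable]:
  "(\<lambda>p. - snd p + fst p) \<in> M \<Otimes>\<^sub>M M \<rightarrow>\<^sub>M M"
  "(\<lambda>p. - fst p + snd p) \<in> M \<Otimes>\<^sub>M M \<rightarrow>\<^sub>M M"
proof -
  have "continuous_on UNIV (\<lambda>p::'a \<times> 'a. - snd p + fst p)"
    and "continuous_on UNIV (\<lambda>p::'a \<times> 'a. - fst p + snd p)"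
    by (intro continuous_intros)+
  then have "(\<lambda>p::'a \<times> 'a. - snd p + fst p) \<in> borel \<Otimes>\<^sub>M borel \<rightarrow>\<^sub>M borel"
    and "(\<lambda>p::'a \<times> 'a. - fst p + snd p) \<in> borel \<Otimes>\<^sub>M borel \<rightarrow>\<^sub>M borel"
    unfolding borel_prod by (auto intro: borel_measurable_continuous_onI)
  then show "(\<lambda>p. - snd p + fst p) \<in> M \<Otimes>\<^sub>M M \<rightarrow>\<^sub>M M" "(\<lambda>p. - fst p + snd p) \<in> M \<Otimes>\<^sub>M M \<rightarrow>\<^sub>M M"
    using measurable_cong_sets[OF sets_pair_measure_cong[OF sets_borel sets_borel] sets_borel]
    by blast+
qed

lemma left_translation_measurable [measurable]: "(\<lambda>x. z + x) \<in> M \<rightarrow>\<^sub>M M"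
proof -
  have "(\<lambda>x::'a. z + x) \<in> borel \<rightarrow>\<^sub>M borel"
    by (intro borel_measurable_continuous_onI continuous_intros)
  then show ?thesis
    using measurable_cong_sets[OF sets_borel sets_borel] by blast
qed

lemma reflected_translation_measurable [measurable]: "(\<lambda>y. - y + x) \<in> M \<rightarrow>\<^sub>M M"
proof -
  have "(\<lambda>y::'a. - y + x) \<in> borel \<rightarrow>\<^sub>M borel"
    by (intro borel_measurable_continuous_onI continuous_intros)
  then show ?thesis
    using measurable_cong_sets[OF sets_borel sets_borel] by blast
qed

lemma distr_left_translation: "distr M M (\<lambda>x. z + x) = M"
proof (rule measure_eqI)
  fix A assume "A \<in> sets (distr M M (\<lambda>x. z + x))"
  then have A: "A \<in> sets M" by simp
  have "(\<lambda>x. z + x) -` A = (\<lambda>y. - z + y) ` A"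
    by (force simp: image_iff add.assoc[symmetric])
  with A show "emeasure (distr M M (\<lambda>x. z + x)) A = emeasure M A"
    by (simp add: emeasure_distr left_invariant sets_borel)
qed simp

lemma nn_integral_left_translation:
  "F \<in> borel_measurable M \<Longrightarrow> (\<integral>\<^sup>+x. F (z + x) \<partial>M) = (\<integral>\<^sup>+x. F x \<partial>M)"
  by (subst (2) distr_left_translation[of z, symmetric]) (simp add: nn_integral_distr)

lemma AE_left_translation:
  assumes [measurable]: "Measurable.pred M P" and "AE x in M. P x"
  shows "AE x in M. P (z + x)"
proof -
  have "AE x in distr M M (\<lambda>x. z + x). P x"
    unfolding distr_left_translation by (rule assms(2))
  then show ?thesis by (rule AE_distrD[rotated]) measurable
qed

text \<open>
  The map \<open>y \<mapsto> - y + x\<close> involves inversion, which need not preserve a left-invariant measure.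
  Exchanging the two quantifiers by Fubini leaves, for fixed \<open>y\<close>, a left translation in \<open>x\<close>, so
  the modular function never enters.  In particular convolution does not see, up to null sets,
  which representative of the second factor is chosen.
\<close>

lemma AE_left_quotient:
  assumes [measurable]: "Measurable.pred M P" and "AE x in M. P x"
  shows "AE x in M. AE y in M. P (- y + x)"
proof -
  have "AE y in M. AE x in M. P (- y + x)"
    using AE_left_translation[OF assms] by simp
  then show ?thesis
    by (subst (asm) pair.AE_commute) (auto)
qed

lemma nn_conv_measurable [measurable]:
  assumes [measurable]: "F \<in> borel_measurable M" "G \<in> borel_measurable M"
  shows "nn_conv M F G \<in> borel_measurable M"
  unfolding nn_conv_def by measurable

text \<open>
  By Tonelli the integral over \<open>x\<close> can be taken first, where left invariance removes the
  translation by \<open>- y\<close>.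
\<close>

lemma nn_integral_nn_conv:
  assumes [measurable]: "F \<in> borel_measurable M" "G \<in> borel_measurable M"
  shows "(\<integral>\<^sup>+x. nn_conv M F G x \<partial>M) = (\<integral>\<^sup>+x. F x \<partial>M) * (\<integral>\<^sup>+x. G x \<partial>M)"
proof -
  have "(\<integral>\<^sup>+x. nn_conv M F G x \<partial>M) = (\<integral>\<^sup>+y. \<integral>\<^sup>+x. F y * G (- y + x) \<partial>M \<partial>M)"
    unfolding nn_conv_def by (rule pair.Fubini') measurable
  also have "\<dots> = (\<integral>\<^sup>+y. F y * (\<integral>\<^sup>+x. G x \<partial>M) \<partial>M)"
    by (simp add: nn_integral_cmult nn_integral_left_translation)
  also have "\<dots> = (\<integral>\<^sup>+x. F x \<partial>M) * (\<integral>\<^sup>+x. G x \<partial>M)"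
    by (simp add: nn_integral_multc)
  finally show ?thesis .
qed

lemma nn_conv_funpow_measurable:
  "F \<in> borel_measurable M \<Longrightarrow> (nn_conv M F ^^ k) F \<in> borel_measurable M"
  by (induction k) auto

lemma nn_conv_power_measurable [measurable]:
  "F \<in> borel_measurable M \<Longrightarrow> nn_conv_power M n F \<in> borel_measurable M"
  unfolding nn_conv_power_def by (rule nn_conv_funpow_measurable)

lemma nn_integral_nn_conv_power:
  assumes "F \<in> borel_measurable M" "1 \<le> n"
  shows "(\<integral>\<^sup>+x. nn_conv_power M n F x \<partial>M) = (\<integral>\<^sup>+x. F x \<partial>M) ^ n"
proof -
  have "(\<integral>\<^sup>+x. (nn_conv M F ^^ k) F x \<partial>M) = (\<integral>\<^sup>+x. F x \<partial>M) ^ Suc k" for k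
    by (induction k)
      (simp_all add: nn_integral_nn_conv nn_conv_funpow_measurable assms(1))
  from this[of "n - 1"] assms(2) show ?thesis by (simp add: nn_conv_power_def)
qed

lemma nn_step_measurable [measurable]:
  assumes [measurable]: "p \<in> borel_measurable M" "F \<in> borel_measurable M"
  shows "nn_step M N a p F \<in> borel_measurable M"
  unfolding nn_step_def by measurable

lemma nn_integral_nn_step:
  assumes [measurable]: "p \<in> borel_measurable M" "F \<in> borel_measurable M"
  shows "(\<integral>\<^sup>+x. nn_step M N a p F x \<partial>M)
    = (\<integral>\<^sup>+x. p x \<partial>M) + (\<Sum>n=2..N. of_nat (a n) * (\<integral>\<^sup>+x. F x \<partial>M) ^ n)"
  unfolding nn_step_def
  by (simp add: nn_integral_add nn_integral_sum nn_integral_cmult nn_integral_nn_conv_power)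

text \<open>
  Monotone convergence, applied for each fixed \<open>x\<close>: the equality holds everywhere, not just
  almost everywhere, so it survives iteration without further argument.
\<close>

lemma nn_conv_SUP:
  assumes [measurable]: "\<And>i. F i \<in> borel_measurable M" "\<And>i. G i \<in> borel_measurable M"
    and inc: "incseq F" "incseq G"
  shows "nn_conv M (SUP i. F i) (SUP i. G i) = (SUP i. nn_conv M (F i) (G i))"
proof
  fix x
  have inc': "incseq (\<lambda>i. F i y)" "incseq (\<lambda>i. G i y)" for y
    using inc by (auto simp: incseq_def le_fun_def)
  have "nn_conv M (SUP i. F i) (SUP i. G i) x = (\<integral>\<^sup>+y. (SUP i. F i y * G i (- y + x)) \<partial>M)"
    unfolding nn_conv_def by (simp add: SUP_mult_incseq_ennreal[OF inc'] image_comp)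
  also have "\<dots> = (SUP i. \<integral>\<^sup>+y. F i y * G i (- y + x) \<partial>M)"
  proof (rule nn_integral_monotone_convergence_SUP)
    show "incseq (\<lambda>i y. F i y * G i (- y + x))"
      using inc unfolding incseq_def le_fun_def by (blast intro: mult_mono zero_le)
  qed measurable
  finally show "nn_conv M (SUP i. F i) (SUP i. G i) x = (SUP i. nn_conv M (F i) (G i)) x"
    by (simp add: nn_conv_def image_comp)
qed

lemma nn_conv_funpow_SUP:
  assumes F: "\<And>i. F i \<in> borel_measurable M" and inc: "incseq F"
  shows "(nn_conv M (SUP i. F i) ^^ k) (SUP i. F i) = (SUP i. (nn_conv M (F i) ^^ k) (F i))"
proof (induction k)
  case (Suc k)
  have "incseq (\<lambda>i. (nn_conv M (F i) ^^ k) (F i))"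
    using inc nn_conv_funpow_mono unfolding incseq_def by blast
  then have "nn_conv M (SUP i. F i) (SUP i. (nn_conv M (F i) ^^ k) (F i))
      = (SUP i. nn_conv M (F i) ((nn_conv M (F i) ^^ k) (F i)))"
    by (intro nn_conv_SUP F nn_conv_funpow_measurable inc)
  then show ?case by (simp only: funpow.simps comp_apply Suc)
qed (simp only: funpow.simps id_apply)

lemma nn_step_SUP:
  assumes F: "\<And>i. F i \<in> borel_measurable M" and inc: "incseq F"
  shows "nn_step M N a p (SUP i. F i) = (SUP i. nn_step M N a p (F i))"
proof
  fix x
  have incn: "incseq (\<lambda>i. of_nat (a n) * nn_conv_power M n (F i) x)" for n
    using inc nn_conv_funpow_mono[of _ _ "n - 1" M]
    unfolding incseq_def nn_conv_power_def le_fun_def by (blast intro: mult_left_mono zero_le)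
  have "nn_step M N a p (SUP i. F i) x
      = p x + (\<Sum>n=2..N. of_nat (a n) * (SUP i. nn_conv_power M n (F i) x))"
    by (simp add: nn_step_def nn_conv_power_def nn_conv_funpow_SUP[OF F inc] image_comp)
  also have "\<dots> = p x + (SUP i. \<Sum>n=2..N. of_nat (a n) * nn_conv_power M n (F i) x)"
    by (simp add: SUP_mult_left_ennreal ennreal_SUP_sum[OF incn])
  also have "\<dots> = (SUP i. nn_step M N a p (F i)) x"
    by (simp add: nn_step_def ennreal_SUP_add_right image_comp)
  finally show "nn_step M N a p (SUP i. F i) x = (SUP i. nn_step M N a p (F i)) x" .
qed

section \<open>Real representatives of non-negative functions\<close>

text \<open>
  The equation is required only almost everywhere because a Bochner integral that diverges takes
  the value 0, so the real and the extended convolution may disagree on a null set.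
\<close>

definition nn_version :: "('a \<Rightarrow> real) \<Rightarrow> ('a \<Rightarrow> ennreal) \<Rightarrow> bool" where
  "nn_version f F \<longleftrightarrow> f \<in> borel_measurable M \<and> F \<in> borel_measurable M \<and>
     (AE x in M. 0 \<le> f x \<and> F x = ennreal (f x))"

lemma nn_version_enn2real:
  assumes [measurable]: "F \<in> borel_measurable M" and "(\<integral>\<^sup>+x. F x \<partial>M) < \<infinity>"
  shows "nn_version (\<lambda>x. enn2real (F x)) F"
proof -
  have "AE x in M. F x \<noteq> \<infinity>"
    using assms by (intro nn_integral_noteq_infinite) auto
  then show ?thesis
    unfolding nn_version_def by (auto simp: less_top)
qed

lemma nn_version_integrable:
  assumes "nn_version f F" and "(\<integral>\<^sup>+x. F x \<partial>M) < \<infinity>"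
  shows "integrable M f"
    and "ennreal (L1_norm M f) = (\<integral>\<^sup>+x. F x \<partial>M)"
proof -
  have [measurable]: "f \<in> borel_measurable M" and ae: "AE x in M. 0 \<le> f x \<and> F x = ennreal (f x)"
    using assms(1) by (auto simp: nn_version_def)
  have eq: "(\<integral>\<^sup>+x. F x \<partial>M) = (\<integral>\<^sup>+x. ennreal (norm (f x)) \<partial>M)"
    using ae by (intro nn_integral_cong_AE) auto
  with assms(2) show i: "integrable M f"
    by (intro integrableI_bounded) auto
  show "ennreal (L1_norm M f) = (\<integral>\<^sup>+x. F x \<partial>M)"
    unfolding L1_norm_def eq using i by (subst nn_integral_eq_integral) auto
qed

text \<open>
  Finite integrals make the extended convolution finite at almost every \<open>x\<close>.  At such an \<open>x\<close>
  the real integrand is integrable in \<open>y\<close>, and the two notions of integral coincide.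
\<close>

lemma nn_version_convolution:
  assumes f: "nn_version f F" and g: "nn_version g G"
    and fin: "(\<integral>\<^sup>+x. F x \<partial>M) < \<infinity>" "(\<integral>\<^sup>+x. G x \<partial>M) < \<infinity>"
  shows "nn_version (convolution M f g) (nn_conv M F G)"
proof -
  have [measurable]: "f \<in> borel_measurable M" "g \<in> borel_measurable M"
      "F \<in> borel_measurable M" "G \<in> borel_measurable M"
    and aef: "AE x in M. 0 \<le> f x \<and> F x = ennreal (f x)"
    and aeg: "AE x in M. 0 \<le> g x \<and> G x = ennreal (g x)"
    using f g by (auto simp: nn_version_def)
  have "(\<integral>\<^sup>+x. nn_conv M F G x \<partial>M) < \<infinity>"
    using fin by (simp add: nn_integral_nn_conv ennreal_mult_less_top)
  then have finite: "AE x in M. nn_conv M F G x \<noteq> \<infinity>"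
    by (intro nn_integral_noteq_infinite) auto
  have "AE x in M. AE y in M. 0 \<le> g (- y + x) \<and> G (- y + x) = ennreal (g (- y + x))"
    by (rule AE_left_quotient[OF _ aeg]) measurable
  with finite
  have "AE x in M. 0 \<le> convolution M f g x \<and> nn_conv M F G x = ennreal (convolution M f g x)"
  proof eventually_elim
    case (elim x)
    have ae: "AE y in M. 0 \<le> f y * g (- y + x) \<and> F y * G (- y + x) = ennreal (f y * g (- y + x))"
      using aef elim(2) by eventually_elim (auto simp: ennreal_mult)
    then have eq: "nn_conv M F G x = (\<integral>\<^sup>+y. ennreal (f y * g (- y + x)) \<partial>M)"
      unfolding nn_conv_def by (intro nn_integral_cong_AE) auto
    have "integrable M (\<lambda>y. f y * g (- y + x))"
      using ae elim(1) eq by (intro integrableI_nonneg) (auto simp: less_top)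
    then have "nn_conv M F G x = ennreal (convolution M f g x)"
      unfolding eq convolution_def using ae by (intro nn_integral_eq_integral) auto
    moreover have "0 \<le> convolution M f g x"
      unfolding convolution_def using ae by (intro integral_nonneg_AE) auto
    ultimately show ?case by simp
  qed
  moreover have "convolution M f g \<in> borel_measurable M"
    unfolding convolution_def by measurable
  ultimately show ?thesis by (simp add: nn_version_def)
qed

lemma nn_version_conv_power:
  assumes f: "nn_version f F" and fin: "(\<integral>\<^sup>+x. F x \<partial>M) < \<infinity>"
  shows "nn_version (conv_power M n f) (nn_conv_power M n F)"
proof -
  have F: "F \<in> borel_measurable M" using f by (simp add: nn_version_def)
  have "nn_version ((convolution M f ^^ k) f) ((nn_conv M F ^^ k) F)" for k
  proof (induction k)
    case (Suc k)
    have "(\<integral>\<^sup>+x. (nn_conv M F ^^ k) F x \<partial>M) < \<infinity>"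
      using nn_integral_nn_conv_power[OF F, of "Suc k"] fin
      by (simp add: nn_conv_power_def power_less_top_ennreal ennreal_mult_less_top)
    with nn_version_convolution[OF f Suc fin] show ?case by simp
  qed (simp add: f)
  then show ?thesis by (simp add: conv_power_def nn_conv_power_def)
qed

lemma nn_version_step:
  assumes \<psi>: "nn_version \<psi> p" and f: "nn_version f F" and fin: "(\<integral>\<^sup>+x. F x \<partial>M) < \<infinity>"
  shows "nn_version (\<lambda>x. \<psi> x + (\<Sum>n=2..N. real (a n) * conv_power M n f x)) (nn_step M N a p F)"
proof -
  have v: "nn_version (conv_power M n f) (nn_conv_power M n F)" for n
    by (rule nn_version_conv_power[OF f fin])
  have [measurable]: "conv_power M n f \<in> borel_measurable M" "\<psi> \<in> borel_measurable M"
      "F \<in> borel_measurable M" "p \<in> borel_measurable M" for n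
    using v[of n] \<psi> f by (auto simp: nn_version_def)
  have "AE x in M. \<forall>n. 0 \<le> conv_power M n f x
      \<and> nn_conv_power M n F x = ennreal (conv_power M n f x)"
    using v by (simp add: AE_all_countable nn_version_def)
  moreover have "AE x in M. 0 \<le> \<psi> x \<and> p x = ennreal (\<psi> x)"
    using \<psi> by (simp add: nn_version_def)
  ultimately have "AE x in M. 0 \<le> \<psi> x + (\<Sum>n=2..N. real (a n) * conv_power M n f x) \<and>
      nn_step M N a p F x = ennreal (\<psi> x + (\<Sum>n=2..N. real (a n) * conv_power M n f x))"
  proof eventually_elim
    case (elim x)
    then have s: "0 \<le> (\<Sum>n=2..N. real (a n) * conv_power M n f x)"
      by (intro sum_nonneg) auto
    have "(\<Sum>n=2..N. of_nat (a n) * nn_conv_power M n F x)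
        = ennreal (\<Sum>n=2..N. real (a n) * conv_power M n f x)"
      using elim by (subst sum_ennreal[symmetric])
        (auto simp: ennreal_mult ennreal_of_nat_eq_real_of_nat)
    with elim s show ?case by (simp add: nn_step_def)
  qed
  then show ?thesis by (simp add: nn_version_def)
qed

section \<open>Convergence of the iteration\<close>

text \<open>
  Any \<open>t \<ge> 0\<close> with \<open>\<parallel>\<psi>\<parallel> \<le> \<Q> t\<close> serves as a bound.  When some \<open>a\<^sub>n\<close> is
  positive, the zero of \<open>\<Q>'\<close> in \<open>(0, \<infinity>)\<close> is the maximum point of
  \<open>\<Q>\<close> on \<open>[0, \<infinity>)\<close>, so choosing it for \<open>t\<close> makes the condition on \<open>\<psi>\<close> as weak as possible.
\<close>

lemma Psi_seq_converges:
  fixes t :: real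
  assumes \<psi>: "integrable M \<psi>" "AE x in M. 0 \<le> \<psi> x"
    and t: "0 \<le> t" "L1_norm M \<psi> \<le> Q_poly N a t"
  shows "(\<forall>j. integrable M (Psi_seq M N a \<psi> j)) \<and>
    (\<exists>\<Psi>. integrable M \<Psi> \<and>
      ((\<lambda>j. L1_norm M (\<lambda>x. Psi_seq M N a \<psi> j x - \<Psi> x)) \<longlonglongrightarrow> 0) \<and>
      (AE x in M. 0 \<le> \<Psi> x) \<and>
      L1_norm M \<Psi> \<le> t \<and>
      (AE x in M. \<psi> x = \<Psi> x - (\<Sum>n=2..N. real (a n) * conv_power M n \<Psi> x)))"
proof -
  define p where "p x = ennreal (\<psi> x)" for x
  define P where "P j = (nn_step M N a p ^^ j) p" for j
  define L where "L = (SUP j. P j)"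
  define \<Psi> where "\<Psi> x = enn2real (L x)" for x
  have [measurable]: "\<psi> \<in> borel_measurable M" using \<psi>(1) by simp
  have p: "nn_version \<psi> p"
    using \<psi> unfolding nn_version_def p_def by auto
  have [measurable]: "p \<in> borel_measurable M" using p by (simp add: nn_version_def)
  have P_meas [measurable]: "P j \<in> borel_measurable M" for j
    unfolding P_def by (induction j) auto
  have L_meas [measurable]: "L \<in> borel_measurable M"
  proof -
    have "(\<lambda>x. SUP j. P j x) \<in> borel_measurable M" by measurable
    then show ?thesis by (simp add: L_def image_comp SUP_apply[abs_def])
  qed
  have incP: "incseq P"
    unfolding P_def by (rule incseq_nn_step_iterates)
  have P_Suc: "P (Suc j) = nn_step M N a p (P j)" for j
    by (simp add: P_def)
  have L1_nonneg: "0 \<le> L1_norm M \<psi>"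
    unfolding L1_norm_def by (intro integral_nonneg_AE) auto
  have int_p: "(\<integral>\<^sup>+x. p x \<partial>M) = ennreal (L1_norm M \<psi>)"
    unfolding p_def L1_norm_def using \<psi>
    by (subst nn_integral_eq_integral) (auto intro!: arg_cong[of _ _ ennreal] integral_cong_AE)
  have Q: "L1_norm M \<psi> + (\<Sum>n=2..N. real (a n) * t ^ n) \<le> t"
    using t(2) by (simp add: Q_poly_def)
  have sum_nonneg': "0 \<le> (\<Sum>n=2..N. real (a n) * t ^ n)"
    using t(1) by (intro sum_nonneg) auto
  have int_P: "(\<integral>\<^sup>+x. P j x \<partial>M) \<le> ennreal t" for j
  proof (induction j)
    case 0
    show ?case using Q sum_nonneg' by (simp add: P_def int_p ennreal_leI)
  next
    case (Suc j)
    have "(\<integral>\<^sup>+x. P (Suc j) x \<partial>M)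
        = ennreal (L1_norm M \<psi>) + (\<Sum>n=2..N. of_nat (a n) * (\<integral>\<^sup>+x. P j x \<partial>M) ^ n)"
      by (simp add: P_Suc nn_integral_nn_step int_p)
    also have "\<dots> \<le> ennreal (L1_norm M \<psi>) + (\<Sum>n=2..N. of_nat (a n) * ennreal t ^ n)"
      using Suc by (intro add_mono sum_mono mult_left_mono power_mono) auto
    also have "(\<Sum>n=2..N. of_nat (a n) * ennreal t ^ n)
        = ennreal (\<Sum>n=2..N. real (a n) * t ^ n)"
      using t(1) by (subst sum_ennreal[symmetric])
        (auto simp: ennreal_mult ennreal_power ennreal_of_nat_eq_real_of_nat)
    also have "ennreal (L1_norm M \<psi>) + \<dots> \<le> ennreal t"
      using Q L1_nonneg sum_nonneg' by (simp add: ennreal_leI flip: ennreal_plus)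
    finally show ?case .
  qed
  have "(\<integral>\<^sup>+x. L x \<partial>M) = (SUP j. \<integral>\<^sup>+x. P j x \<partial>M)"
    unfolding L_def using nn_integral_monotone_convergence_SUP[OF incP P_meas]
    by (simp add: image_comp)
  also have "\<dots> \<le> ennreal t" using int_P by (rule SUP_least)
  finally have int_L: "(\<integral>\<^sup>+x. L x \<partial>M) \<le> ennreal t" .
  have fin_P: "(\<integral>\<^sup>+x. P j x \<partial>M) < \<infinity>" for j
    using le_less_trans[OF int_P ennreal_less_top] by simp
  have fin_L: "(\<integral>\<^sup>+x. L x \<partial>M) < \<infinity>"
    using le_less_trans[OF int_L ennreal_less_top] by simp
  have L_fix: "L = nn_step M N a p L"
  proof -
    have "nn_step M N a p L = (SUP j. P (Suc j))"
      unfolding L_def by (simp add: nn_step_SUP[OF P_meas incP] P_Suc)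
    also have "\<dots> = L"
      unfolding L_def
    proof (rule antisym)
      show "(SUP j. P (Suc j)) \<le> (SUP j. P j)"
        by (intro SUP_least SUP_upper) auto
      show "(SUP j. P j) \<le> (SUP j. P (Suc j))"
        using incP by (intro SUP_mono' incseq_SucD)
    qed
    finally show ?thesis ..
  qed
  have vP: "nn_version (Psi_seq M N a \<psi> j) (P j)" for j
  proof (induction j)
    case 0
    show ?case using p by (simp add: P_def)
  next
    case (Suc j)
    from nn_version_step[OF p Suc fin_P] show ?case by (simp add: P_Suc)
  qed
  have vL: "nn_version \<Psi> L"
    unfolding \<Psi>_def by (rule nn_version_enn2real[OF L_meas fin_L])
  have int\<Psi>: "integrable M \<Psi>"
    by (rule nn_version_integrable(1)[OF vL fin_L])
  have [measurable]: "Psi_seq M N a \<psi> j \<in> borel_measurable M" "\<Psi> \<in> borel_measurable M" for j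
    using vP[of j] vL by (auto simp: nn_version_def)
  have aeP: "AE x in M. \<forall>j. 0 \<le> Psi_seq M N a \<psi> j x \<and> P j x = ennreal (Psi_seq M N a \<psi> j x)"
    using vP by (simp add: AE_all_countable nn_version_def)
  have aeL: "AE x in M. 0 \<le> \<Psi> x \<and> L x = ennreal (\<Psi> x)"
    using vL by (simp add: nn_version_def)
  have bound: "AE x in M. \<forall>j. norm \<bar>Psi_seq M N a \<psi> j x - \<Psi> x\<bar> \<le> \<Psi> x"
    using aeP aeL
  proof eventually_elim
    case (elim x)
    have "0 \<le> Psi_seq M N a \<psi> j x \<and> Psi_seq M N a \<psi> j x \<le> \<Psi> x" for j
    proof -
      have "P j x \<le> (SUP j. P j x)" by (rule SUP_upper) simp
      then have "P j x \<le> L x" by (simp add: L_def image_comp)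
      with elim show ?thesis by simp
    qed
    then show ?case by simp
  qed
  have lim: "AE x in M. (\<lambda>j. \<bar>Psi_seq M N a \<psi> j x - \<Psi> x\<bar>) \<longlonglongrightarrow> 0"
    using aeP aeL
  proof eventually_elim
    case (elim x)
    have "(\<lambda>j. P j x) \<longlonglongrightarrow> (SUP j. P j x)"
      using incP by (intro LIMSEQ_SUP) (auto simp: incseq_def le_fun_def)
    then have "(\<lambda>j. ennreal (Psi_seq M N a \<psi> j x)) \<longlonglongrightarrow> ennreal (\<Psi> x)"
      using elim by (simp add: L_def image_comp)
    then have "(\<lambda>j. Psi_seq M N a \<psi> j x) \<longlonglongrightarrow> \<Psi> x"
      using elim by (simp add: tendsto_ennreal_iff)
    then show ?case
      by (intro tendsto_rabs_zero) (simp add: LIM_zero)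
  qed
  have "(\<lambda>j. L1_norm M (\<lambda>x. Psi_seq M N a \<psi> j x - \<Psi> x)) \<longlonglongrightarrow> (\<integral>x. 0 \<partial>M)"
    unfolding L1_norm_def
    by (rule integral_dominated_convergence[OF _ _ int\<Psi> lim])
      (use bound in \<open>auto simp: AE_all_countable\<close>)
  moreover have "AE x in M. \<psi> x = \<Psi> x - (\<Sum>n=2..N. real (a n) * conv_power M n \<Psi> x)"
  proof -
    have "nn_version (\<lambda>x. \<psi> x + (\<Sum>n=2..N. real (a n) * conv_power M n \<Psi> x)) L"
      using nn_version_step[OF p vL fin_L, of a N] L_fix by simp
    then have "AE x in M. 0 \<le> \<psi> x + (\<Sum>n=2..N. real (a n) * conv_power M n \<Psi> x) \<and>
        L x = ennreal (\<psi> x + (\<Sum>n=2..N. real (a n) * conv_power M n \<Psi> x))"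
      by (simp add: nn_version_def)
    with aeL show ?thesis by eventually_elim auto
  qed
  moreover have "L1_norm M \<Psi> \<le> t"
    using int_L t(1) by (simp add: ennreal_le_iff flip: nn_version_integrable(2)[OF vL fin_L])
  moreover have "AE x in M. 0 \<le> \<Psi> x"
    using aeL by auto
  ultimately show ?thesis
    using nn_version_integrable(1)[OF vP fin_P] int\<Psi> by auto
qed

end

section \<open>Haar measure on second countable groups\<close>

text \<open>
  The open sets contained in compact sets have finite measure and cover the space; the Lindelof
  property extracts a countable subcover.
\<close>

lemma sigma_finite_measure_locally_compact:
  fixes M :: "'a::{t2_space, second_countable_topology} measure"
  assumes lc: "locally_compact_space (euclidean :: 'a topology)"
    and sets: "sets M = sets borel"
    and fin: "\<And>K. compact K \<Longrightarrow> emeasure M K < \<infinity>"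
  shows "sigma_finite_measure M"
proof
  define \<U> :: "'a set set" where "\<U> = {U. open U \<and> (\<exists>K. compact K \<and> U \<subseteq> K)}"
  have "\<Union>\<U> = (UNIV :: 'a set)"
    using lc unfolding locally_compact_space_def \<U>_def
    by (auto simp: compactin_euclidean_iff) blast
  moreover obtain \<V> where \<V>: "\<V> \<subseteq> \<U>" "countable \<V>" "\<Union>\<V> = \<Union>\<U>"
    by (rule Lindelof[of \<U>]) (auto simp: \<U>_def)
  moreover have "emeasure M U \<noteq> \<infinity>" if "U \<in> \<U>" for U
  proof -
    from that obtain K where K: "compact K" "U \<subseteq> K" by (auto simp: \<U>_def)
    then have "emeasure M U \<le> emeasure M K"
      by (intro emeasure_mono) (auto simp: sets compact_imp_closed)
    with fin[OF K(1)] show ?thesis by (auto simp: top_unique)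
  qed
  moreover have "\<U> \<subseteq> sets M" by (auto simp: \<U>_def sets)
  ultimately show
    "\<exists>A. countable A \<and> A \<subseteq> sets M \<and> \<Union>A = space M \<and> (\<forall>a\<in>A. emeasure M a \<noteq> \<infinity>)"
    using sets_eq_imp_space_eq[OF sets] by (intro exI[of _ \<V>]) auto
qed

theorem theorem1p1:
  fixes M :: "'a::{topological_group_add, t2_space, second_countable_topology} measure"
    and N :: nat
    and a :: "nat \<Rightarrow> nat"
    and \<psi> :: "'a \<Rightarrow> real"
  assumes "locally_compact_space (euclidean :: 'a topology)"
    and "left_haar_measure M"
    and "2 \<le> N"
    and "\<exists>n\<in>{2..N}. 0 < a n"
    and "integrable M \<psi>"
    and "AE x in M. 0 \<le> \<psi> x"
    and "L1_norm M \<psi> \<le> Q_poly N a (t_Q N a)"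
  shows "(\<forall>j. integrable M (Psi_seq M N a \<psi> j)) \<and>
    (\<exists>\<Psi>. integrable M \<Psi> \<and>
      ((\<lambda>j. L1_norm M (\<lambda>x. Psi_seq M N a \<psi> j x - \<Psi> x)) \<longlonglongrightarrow> 0) \<and>
      (AE x in M. 0 \<le> \<Psi> x) \<and>
      L1_norm M \<Psi> \<le> t_Q N a \<and>
      (AE x in M. \<psi> x = \<Psi> x - (\<Sum>n=2..N. real (a n) * conv_power M n \<Psi> x)))"
proof -
  have "sigma_finite_measure M"
    using assms(2)
    by (intro sigma_finite_measure_locally_compact[OF assms(1)]) (auto simp: left_haar_measure_def)
  moreover have "left_invariant_sigma_finite_axioms M"
    using assms(2) unfolding left_haar_measure_def by unfold_locales auto
  ultimately interpret left_invariant_sigma_finite M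
    by (rule left_invariant_sigma_finite.intro)
  have "0 < t_Q N a"
    unfolding t_Q_def using theI'[OF ex1_t_Q[OF assms(4)]] by simp
  with assms(5-7) show ?thesis
    by (intro Psi_seq_converges) auto
qed

end
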